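(* Let $\mathcal S$ be a finite poset, $\chi=(\chi_s)_{s\in\mathcal S}$ a weight with positive integer components, and let $U=(U_0;U_s)_{s\in\mathcal S}$ be a $\chi$-representation of $\mathcal S$. Then the underlying subspace representation of $\mathcal S$ over $\mathbb C$ (obtained from $U$ by forgetting the inner product on $U_0$) is $\mu_\theta$-polystable with $\theta=(\chi_s)_{s\in\mathcal S}$.
   Context: A subspace representation of $\mathcal S$ over $\mathbb C$ is a tuple $V=(V_0;V_s)_{s\in\mathcal S}$ with $V_0$ a (nonzero) finite dimensional complex vector space and subspaces $V_s\subseteq V_0$ with $V_s\subseteq V_t$ if $s\prec t$. A unitary representation of $\mathcal S$ is a subspace representation $U=(U_0;U_s)_{s\in\mathcal S}$ whose ambient space $U_0$ is a unitary (finite dimensional complex inner product) space. It is a $\chi$-representation if $\sum_{s\in\mathcal S}\chi_sP_{U_s}=\chi_0I$ for a scalar $\chi_0$ (determined by the trace), where $P_M$ is the orthogonal projection of $U_0$ onto $M$. For a representation $V$ with $V_0\neq0$, $\mu_\theta(V)=\frac1{\dim V_0}\sum_{s\in\mathcal S}\theta_s\dim V_s$. A proper subrepresentation of $V$ is $V_K=(K;V_s\cap K)_{s\in\mathcal S}$ with $0\ne K\subsetneq V_0$. $V$ is $\mu_\theta$-stable (resp. $\mu_\theta$-semistable) if $\mu_\theta(W)<\mu_\theta(V)$ (resp. $\le$) for every proper subrepresentation $W$. $V$ is $\mu_\theta$-polystable if it is $\mu_\theta$-semistable and decomposes as a direct sum (of subspace representations) of finitely many $\mu_\theta$-stable subrepresentations.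 *)

theory Defs
  imports Complex_Main
begin

text \<open>
  All spaces are subspaces of an ambient complex vector space \<open>'v\<close> (of any dimension), so that
  subrepresentations are representations over the same type. A poset is a carrier \<open>S\<close> with a
  reflexive order relation \<open>r\<close>; a tuple \<open>(V0; V s)\<close> is the pair \<open>V0\<close>, \<open>V\<close>, and the
  values of \<open>V\<close> outside \<open>S\<close> are irrelevant.
\<close>

locale complex_vspace = vector_space scale
  for scale :: "complex \<Rightarrow> 'v::ab_group_add \<Rightarrow> 'v" (infixr \<open>*s\<close> 75)
begin

definition subspace_rep :: "'s set \<Rightarrow> 's rel \<Rightarrow> 'v set \<Rightarrow> ('s \<Rightarrow> 'v set) \<Rightarrow> bool" where
  "subspace_rep S r V0 V \<longleftrightarrow>
     subspace V0 \<and> V0 \<noteq> {0} \<and> (\<exists>B. finite B \<and> span B = V0) \<and>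
     (\<forall>s\<in>S. subspace (V s) \<and> V s \<subseteq> V0) \<and>
     (\<forall>s\<in>S. \<forall>t\<in>S. (s, t) \<in> r \<longrightarrow> V s \<subseteq> V t)"

text \<open>An inner product need only be given on \<open>U0\<close>; it is linear in the first argument.\<close>

definition inner_product_on :: "'v set \<Rightarrow> ('v \<Rightarrow> 'v \<Rightarrow> complex) \<Rightarrow> bool" where
  "inner_product_on U0 ip \<longleftrightarrow>
     (\<forall>x\<in>U0. \<forall>y\<in>U0. \<forall>z\<in>U0. ip (x + y) z = ip x z + ip y z) \<and>
     (\<forall>a. \<forall>x\<in>U0. \<forall>y\<in>U0. ip (a *s x) y = a * ip x y) \<and>
     (\<forall>x\<in>U0. \<forall>y\<in>U0. ip y x = cnj (ip x y)) \<and>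
     (\<forall>x\<in>U0. x \<noteq> 0 \<longrightarrow> ip x x \<in> \<real> \<and> 0 < Re (ip x x))"

definition unitary_rep ::
  "('v \<Rightarrow> 'v \<Rightarrow> complex) \<Rightarrow> 's set \<Rightarrow> 's rel \<Rightarrow> 'v set \<Rightarrow> ('s \<Rightarrow> 'v set) \<Rightarrow> bool" where
  "unitary_rep ip S r U0 U \<longleftrightarrow> subspace_rep S r U0 U \<and> inner_product_on U0 ip"

text \<open>
  The unique point of \<open>M\<close> whose difference from \<open>x\<close> is orthogonal to \<open>M\<close>. Existence and
  uniqueness hold for \<open>x \<in> U0\<close> and \<open>M\<close> a subspace of a finite-dimensional \<open>U0\<close> on which
  \<open>ip\<close> is an inner product; it is not used otherwise.
\<close>

definition orth_proj :: "('v \<Rightarrow> 'v \<Rightarrow> complex) \<Rightarrow> 'v set \<Rightarrow> 'v \<Rightarrow> 'v" where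
  "orth_proj ip M x = (THE p. p \<in> M \<and> (\<forall>m\<in>M. ip (x - p) m = 0))"

definition chi_rep ::
  "('v \<Rightarrow> 'v \<Rightarrow> complex) \<Rightarrow> 's set \<Rightarrow> 's rel \<Rightarrow> ('s \<Rightarrow> nat) \<Rightarrow> 'v set \<Rightarrow> ('s \<Rightarrow> 'v set) \<Rightarrow> bool" where
  "chi_rep ip S r \<chi> U0 U \<longleftrightarrow>
     unitary_rep ip S r U0 U \<and>
     (\<exists>\<chi>0. \<forall>x\<in>U0. (\<Sum>s\<in>S. of_nat (\<chi> s) *s orth_proj ip (U s) x) = \<chi>0 *s x)"

definition slope :: "'s set \<Rightarrow> ('s \<Rightarrow> real) \<Rightarrow> 'v set \<Rightarrow> ('s \<Rightarrow> 'v set) \<Rightarrow> real" where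
  "slope S \<theta> V0 V = 1 / real (dim V0) * (\<Sum>s\<in>S. \<theta> s * real (dim (V s)))"

definition restrict_rep :: "('s \<Rightarrow> 'v set) \<Rightarrow> 'v set \<Rightarrow> ('s \<Rightarrow> 'v set)" where
  "restrict_rep V K = (\<lambda>s. V s \<inter> K)"

definition mu_stable ::
  "'s set \<Rightarrow> 's rel \<Rightarrow> ('s \<Rightarrow> real) \<Rightarrow> 'v set \<Rightarrow> ('s \<Rightarrow> 'v set) \<Rightarrow> bool" where
  "mu_stable S r \<theta> V0 V \<longleftrightarrow> subspace_rep S r V0 V \<and>
     (\<forall>K. subspace K \<and> K \<noteq> {0} \<and> K \<subset> V0 \<longrightarrow>
        slope S \<theta> K (restrict_rep V K) < slope S \<theta> V0 V)"

definition mu_semistable ::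
  "'s set \<Rightarrow> 's rel \<Rightarrow> ('s \<Rightarrow> real) \<Rightarrow> 'v set \<Rightarrow> ('s \<Rightarrow> 'v set) \<Rightarrow> bool" where
  "mu_semistable S r \<theta> V0 V \<longleftrightarrow> subspace_rep S r V0 V \<and>
     (\<forall>K. subspace K \<and> K \<noteq> {0} \<and> K \<subset> V0 \<longrightarrow>
        slope S \<theta> K (restrict_rep V K) \<le> slope S \<theta> V0 V)"

text \<open>\<open>W\<close> is the internal direct sum of the subspaces \<open>K i\<close>, \<open>i < n\<close>.\<close>

definition direct_sum_of :: "nat \<Rightarrow> (nat \<Rightarrow> 'v set) \<Rightarrow> 'v set \<Rightarrow> bool" where
  "direct_sum_of n K W \<longleftrightarrow>
     (\<forall>i<n. subspace (K i)) \<and>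
     W = {\<Sum>i<n. f i |f. \<forall>i<n. f i \<in> K i} \<and>
     (\<forall>f. (\<forall>i<n. f i \<in> K i) \<and> (\<Sum>i<n. f i) = 0 \<longrightarrow> (\<forall>i<n. f i = 0))"

text \<open>
  A direct sum of representations is formed componentwise, so a decomposition must split both
  \<open>V0\<close> and every \<open>V s\<close>. The summands may include \<open>V\<close> itself (with \<open>n = 1\<close>).
\<close>

definition mu_polystable ::
  "'s set \<Rightarrow> 's rel \<Rightarrow> ('s \<Rightarrow> real) \<Rightarrow> 'v set \<Rightarrow> ('s \<Rightarrow> 'v set) \<Rightarrow> bool" where
  "mu_polystable S r \<theta> V0 V \<longleftrightarrow> mu_semistable S r \<theta> V0 V \<and>
     (\<exists>n K. direct_sum_of n K V0 \<and>
        (\<forall>s\<in>S. direct_sum_of n (\<lambda>i. restrict_rep V (K i) s) (V s)) \<and>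
        (\<forall>i<n. mu_stable S r \<theta> (K i) (restrict_rep V (K i))))"

end

end

theory Submission
  imports Defs
begin

text \<open>
  Write \<open>P\<^sub>s\<close> for the orthogonal projection onto \<open>U s\<close>. Compressing \<open>\<Sum>s. \<chi> s P\<^sub>s = \<chi>0 I\<close> to a subspace
  \<open>K\<close> and taking traces gives \<open>\<chi>0 dim K = \<Sum>s. \<chi> s tr(P\<^sub>K P\<^sub>s P\<^sub>K)\<close>. The trace of \<open>P\<^sub>K P\<^sub>s P\<^sub>K\<close> is at
  least \<open>dim (U s \<inter> K)\<close>, since this operator is positive and is the identity on \<open>U s \<inter> K\<close>. So the
  slope of \<open>K\<close> is at most \<open>\<chi>0\<close>, which is the slope of \<open>U\<close> itself (take \<open>K = U0\<close>): this is
  semistability.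

  If \<open>K\<close> has slope exactly \<open>\<chi>0\<close>, all these trace inequalities are equalities because the weights are
  positive, and this means \<open>U s = (U s \<inter> K) \<oplus> (U s \<inter> K')\<close> for every \<open>s\<close>, where \<open>K'\<close> is the
  orthogonal complement of \<open>K\<close>. Both \<open>K\<close> and \<open>K'\<close> then inherit the projection identity with the
  same scalar. Hence a representation that is not stable is the orthogonal sum of two smaller ones of
  the same kind, and induction on the dimension decomposes it into stable summands.

  Traces are handled through orthonormal bases: if \<open>E\<close> is one of \<open>K\<close> and \<open>F\<close> one of \<open>U s\<close>, then
  \<open>tr(P\<^sub>K P\<^sub>s P\<^sub>K)\<close> is the double sum of \<open>\<bar>ip f e\<bar>\<^sup>2\<close> over \<open>f \<in> F\<close> and \<open>e \<in> E\<close>. The projection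
  identity is used only through its quadratic form \<open>weighted_parseval\<close>. The trace inequality and its
  equality case are \<open>weighted_dim_le\<close> and \<open>weighted_dim_eq_split\<close>; heredity is
  \<open>weighted_parseval_summand\<close>; the induction is \<open>weighted_parseval_decomposition\<close>.
\<close>

section \<open>Orthonormal bases in a subspace carrying an inner product\<close>

locale finite_dim_inner_product_space = complex_vspace scale
  for scale :: "complex \<Rightarrow> 'v::ab_group_add \<Rightarrow> 'v" (infixr \<open>*s\<close> 75) +
  fixes ip :: "'v \<Rightarrow> 'v \<Rightarrow> complex" and H :: "'v set"
  assumes subspace_H: "subspace H"
    and finite_span_H: "\<exists>B. finite B \<and> span B = H"
    and ip_H: "inner_product_on H ip"
begin

lemma ip_add_left: "x \<in> H \<Longrightarrow> y \<in> H \<Longrightarrow> z \<in> H \<Longrightarrow> ip (x + y) z = ip x z + ip y z"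
  using ip_H unfolding inner_product_on_def by blast

lemma ip_scale_left: "x \<in> H \<Longrightarrow> y \<in> H \<Longrightarrow> ip (a *s x) y = a * ip x y"
  using ip_H unfolding inner_product_on_def by blast

lemma ip_cnj: "x \<in> H \<Longrightarrow> y \<in> H \<Longrightarrow> ip y x = cnj (ip x y)"
  using ip_H unfolding inner_product_on_def by blast

lemma ip_self_pos: "x \<in> H \<Longrightarrow> x \<noteq> 0 \<Longrightarrow> ip x x \<in> \<real> \<and> 0 < Re (ip x x)"
  using ip_H unfolding inner_product_on_def by blast

lemma zero_in_H: "0 \<in> H"
  using subspace_0[OF subspace_H] .

lemma ip_zero_left: "y \<in> H \<Longrightarrow> ip 0 y = 0"
  using ip_scale_left[OF zero_in_H, of y 0] by simp

lemma ip_zero_right: "y \<in> H \<Longrightarrow> ip y 0 = 0"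
  using ip_cnj[OF zero_in_H, of y] ip_zero_left by simp

lemma ip_self_real: "x \<in> H \<Longrightarrow> ip x x = of_real (Re (ip x x))"
  by (cases "x = 0") (auto simp: ip_zero_left ip_self_pos)

lemma ip_eq_0_iff: "x \<in> H \<Longrightarrow> ip x x = 0 \<longleftrightarrow> x = 0"
  using ip_self_pos[of x] ip_zero_left[OF zero_in_H] by fastforce

lemma ip_diff_left:
  assumes "x \<in> H" "y \<in> H" "z \<in> H" shows "ip (x - y) z = ip x z - ip y z"
  using ip_add_left[of "x - y" y z] subspace_diff[OF subspace_H, of x y] assms by simp

lemma ip_swap_0: "x \<in> H \<Longrightarrow> y \<in> H \<Longrightarrow> ip x y = 0 \<Longrightarrow> ip y x = 0"
  using ip_cnj[of x y] by simp

lemma norm_ip_swap: "x \<in> H \<Longrightarrow> y \<in> H \<Longrightarrow> cmod (ip x y) = cmod (ip y x)"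
  using ip_cnj[of x y] by simp

lemma ip_sum_left:
  assumes "finite I" "\<And>i. i \<in> I \<Longrightarrow> v i \<in> H" "y \<in> H"
  shows "ip (\<Sum>i\<in>I. a i *s v i) y = (\<Sum>i\<in>I. a i * ip (v i) y)"
  using assms
proof (induction I rule: finite_induct)
  case (insert i I)
  have "(\<Sum>i\<in>I. a i *s v i) \<in> H"
    using insert by (intro subspace_sum subspace_scale subspace_H) auto
  then show ?case
    using insert by (simp add: ip_add_left ip_scale_left subspace_scale subspace_H)
qed (simp add: ip_zero_left)

definition orthonormal :: "'v set \<Rightarrow> bool" where
  "orthonormal E \<longleftrightarrow> finite E \<and> E \<subseteq> H \<and> (\<forall>e\<in>E. \<forall>f\<in>E. ip e f = (if e = f then 1 else 0))"

definition orthonormal_basis :: "'v set \<Rightarrow> 'v set \<Rightarrow> bool" where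
  "orthonormal_basis E M \<longleftrightarrow> orthonormal E \<and> span E = M"

lemma ip_orthonormal_sum:
  assumes "orthonormal E" "e \<in> E"
  shows "ip (\<Sum>f\<in>E. a f *s f) e = a e"
proof -
  have "ip (\<Sum>f\<in>E. a f *s f) e = (\<Sum>f\<in>E. a f * ip f e)"
    using assms by (intro ip_sum_left) (auto simp: orthonormal_def)
  also have "\<dots> = (\<Sum>f\<in>E. if f = e then a f else 0)"
    using assms by (intro sum.cong) (auto simp: orthonormal_def)
  finally show ?thesis using assms by (simp add: orthonormal_def)
qed

lemma orthonormal_independent:
  assumes "orthonormal E" shows "independent E"
proof (rule independent_if_scalars_zero)
  show "finite E" using assms by (simp add: orthonormal_def)
  fix a e assume "(\<Sum>f\<in>E. a f *s f) = 0" "e \<in> E"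
  then show "a e = 0"
    using ip_orthonormal_sum[OF assms, of e a] assms by (auto simp: orthonormal_def ip_zero_left)
qed

lemma orthonormal_basisD:
  assumes "orthonormal_basis E M"
  shows "orthonormal E" "finite E" "E \<subseteq> M" "E \<subseteq> H" "subspace M" "M \<subseteq> H" "span E = M"
    and "dim M = card E"
proof -
  show E: "orthonormal E" "finite E" "E \<subseteq> H" "E \<subseteq> M" "span E = M" "subspace M"
    using assms span_superset[of E] by (auto simp: orthonormal_basis_def orthonormal_def)
  show "M \<subseteq> H" using span_minimal[OF E(3) subspace_H] E(5) by simp
  show "dim M = card E"
    using dim_span_eq_card_independent[OF orthonormal_independent[OF E(1)]] E(5) by simp
qed

lemma orthonormal_basis_expansion:
  assumes "orthonormal_basis E M" "x \<in> M"
  shows "x = (\<Sum>e\<in>E. ip x e *s e)"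
proof -
  note E = orthonormal_basisD[OF assms(1)]
  obtain a where a: "x = (\<Sum>e\<in>E. a e *s e)"
    using assms(2) E(7) span_finite[OF E(2)] by auto
  have "a e = ip x e" if "e \<in> E" for e
    using ip_orthonormal_sum[OF E(1) that, of a] by (simp add: a)
  then show ?thesis by (subst a) (intro sum.cong refl, simp)
qed

lemma ip_orthonormal_sum_self:
  assumes "orthonormal E" and x: "x \<in> H"
  shows "ip (\<Sum>e\<in>E. ip x e *s e) x = of_real (\<Sum>e\<in>E. (cmod (ip x e))\<^sup>2)"
proof -
  have E: "finite E" "E \<subseteq> H" using assms(1) by (auto simp: orthonormal_def)
  have "ip (\<Sum>e\<in>E. ip x e *s e) x = (\<Sum>e\<in>E. ip x e * ip e x)"
    using E x by (intro ip_sum_left) auto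
  also have "\<dots> = (\<Sum>e\<in>E. of_real ((cmod (ip x e))\<^sup>2))"
    using E x by (intro sum.cong refl) (metis complex_norm_square ip_cnj subsetD)
  finally show ?thesis by simp
qed

lemma parseval:
  assumes "orthonormal_basis E M" "x \<in> M"
  shows "Re (ip x x) = (\<Sum>e\<in>E. (cmod (ip x e))\<^sup>2)"
proof -
  note E = orthonormal_basisD[OF assms(1)]
  have x: "x \<in> H" using E(6) assms(2) by auto
  show ?thesis
    using ip_orthonormal_sum_self[OF E(1) x]
    by (simp only: orthonormal_basis_expansion[OF assms, symmetric] Re_complex_of_real)
qed

text \<open>
  One Gram--Schmidt step: the new vector is \<open>x\<close> minus its projection onto \<open>span E\<close>, normalized.
\<close>

lemma orthonormal_insert:
  assumes E: "orthonormal E" and M: "subspace M" "M \<subseteq> H" "E \<subseteq> M" and x: "x \<in> M" "x \<notin> span E"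
  shows "\<exists>y. y \<in> M \<and> y \<notin> E \<and> orthonormal (insert y E)"
proof -
  define p where "p = (\<Sum>e\<in>E. ip x e *s e)"
  define w where "w = x - p"
  define c where "c = complex_of_real (1 / sqrt (Re (ip w w)))"
  have fin: "finite E" "E \<subseteq> H" using E by (auto simp: orthonormal_def)
  have p: "p \<in> span E" unfolding p_def
    by (intro span_sum span_scale span_base)
  have pM: "p \<in> M" using p span_minimal[OF M(3,1)] by auto
  have wM: "w \<in> M" and wH: "w \<in> H" using x pM M by (auto simp: w_def subspace_diff)
  have w0: "w \<noteq> 0" using x p by (auto simp: w_def)
  have we: "ip w e = 0" if "e \<in> E" for e
    using ip_orthonormal_sum[OF E that, of "ip x"] that x M fin pM
    by (simp add: w_def p_def[symmetric] ip_diff_left subset_iff)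
  have pos: "0 < Re (ip w w)" using ip_self_pos[OF wH w0] by simp
  define y where "y = c *s w"
  have yH: "y \<in> H" and yM: "y \<in> M"
    using wM wH M subspace_H by (auto simp: y_def subspace_scale)
  have ye: "ip y e = 0" "ip e y = 0" if "e \<in> E" for e
  proof -
    show "ip y e = 0" using we[OF that] that fin wH by (auto simp: y_def ip_scale_left)
    then show "ip e y = 0" using ip_swap_0 that fin yH by auto
  qed
  have yy: "ip y y = 1"
  proof -
    have "ip y y = c * cnj (c * ip w w)"
      using wH yH ip_cnj[of y w] by (simp add: y_def ip_scale_left)
    also have "\<dots> = of_real ((1 / sqrt (Re (ip w w)))\<^sup>2 * Re (ip w w))"
      by (subst ip_self_real[OF wH])
        (simp only: c_def power2_eq_square of_real_mult complex_cnj_mult complex_cnj_complex_of_real mult_ac)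
    also have "\<dots> = 1" using pos by (simp add: power_divide)
    finally show ?thesis .
  qed
  have "y \<notin> E" using ye(1)[of y] yy by auto
  moreover have "orthonormal (insert y E)"
    using E ye yy yH \<open>y \<notin> E\<close> by (auto simp: orthonormal_def)
  ultimately show ?thesis using yM by blast
qed

lemma orthonormal_card_bounded: "\<exists>N. \<forall>E. orthonormal E \<longrightarrow> card E \<le> N"
proof -
  obtain B where B: "finite B" "span B = H" using finite_span_H by blast
  have "card E \<le> card B" if "orthonormal E" for E
    using independent_span_bound[OF B(1) orthonormal_independent[OF that]] B(2) that
    by (auto simp: orthonormal_def)
  then show ?thesis by blast
qed

text \<open>
  An orthonormal set of maximal cardinality between \<open>E\<close> and \<open>M\<close> spans \<open>M\<close>, since a Gram--Schmidt
  step would otherwise enlarge it.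
\<close>

lemma orthonormal_basis_extend:
  assumes E: "orthonormal E" and M: "subspace M" "M \<subseteq> H" "E \<subseteq> M"
  shows "\<exists>F. E \<subseteq> F \<and> orthonormal_basis F M"
proof -
  obtain N where N: "\<And>E. orthonormal E \<Longrightarrow> card E \<le> N" using orthonormal_card_bounded by blast
  define P where "P G \<longleftrightarrow> E \<subseteq> G \<and> G \<subseteq> M \<and> orthonormal G" for G
  have "P E" using E M(3) by (simp add: P_def)
  moreover have "\<forall>G. P G \<longrightarrow> card G < Suc N" using N by (simp add: P_def less_Suc_eq_le)
  ultimately obtain F where PF: "P F" and max: "\<And>G. P G \<Longrightarrow> card G \<le> card F"
    using ex_has_greatest_nat[of P E card "Suc N"] by metis
  have F: "E \<subseteq> F" "F \<subseteq> M" "orthonormal F" using PF by (simp_all add: P_def)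
  have "M \<subseteq> span F"
  proof
    fix x assume x: "x \<in> M"
    show "x \<in> span F"
    proof (rule ccontr)
      assume "x \<notin> span F"
      then obtain y where y: "y \<in> M" "y \<notin> F" "orthonormal (insert y F)"
        using orthonormal_insert[OF F(3) M(1,2) F(2) x] by blast
      have "card (insert y F) \<le> card F" using y F by (intro max) (auto simp: P_def)
      then show False using y F(3) by (simp add: orthonormal_def)
    qed
  qed
  then have "span F = M" using span_minimal[OF F(2) M(1)] by auto
  then show ?thesis using F by (auto simp: orthonormal_basis_def)
qed

lemma orthonormal_basis_exists:
  assumes "subspace M" "M \<subseteq> H" shows "\<exists>F. orthonormal_basis F M"
  using orthonormal_basis_extend[of "{}" M] assms by (auto simp: orthonormal_def)

lemma dim_strict_mono:
  assumes "subspace K" "subspace M" "K \<subset> M" "M \<subseteq> H" shows "dim K < dim M"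
proof -
  obtain E where E: "orthonormal_basis E K" using orthonormal_basis_exists assms by blast
  note E' = orthonormal_basisD[OF E]
  obtain F where F: "E \<subseteq> F" "orthonormal_basis F M"
    using orthonormal_basis_extend[of E M] E' assms by blast
  note F' = orthonormal_basisD[OF F(2)]
  have "E \<subset> F" using F(1) E'(7) F'(7) assms(3) by auto
  then show ?thesis using psubset_card_mono[OF F'(2)] E'(8) F'(8) by simp
qed

lemma dim_pos:
  assumes "subspace K" "K \<noteq> {0}" "K \<subseteq> H" shows "0 < dim K"
proof -
  have "{0} \<subset> K" using assms(2) subspace_0[OF assms(1)] by blast
  then show ?thesis using dim_strict_mono[of "{0}" K] assms by simp
qed

lemma orth_proj_orthonormal_basis:
  assumes F: "orthonormal_basis F M" and x: "x \<in> H"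
  shows "orth_proj ip M x = (\<Sum>f\<in>F. ip x f *s f)"
  unfolding orth_proj_def
proof (rule the_equality)
  note F' = orthonormal_basisD[OF F]
  let ?p = "\<Sum>f\<in>F. ip x f *s f"
  have p: "?p \<in> M" using F' by (intro subspace_sum subspace_scale) auto
  have pf: "ip f (x - ?p) = 0" if "f \<in> F" for f
  proof (rule ip_swap_0)
    show "ip (x - ?p) f = 0"
      using ip_orthonormal_sum[OF F'(1) that, of "ip x"] x p F' that
      by (subst ip_diff_left) auto
  qed (use x p F' that subspace_H in \<open>auto intro!: subspace_diff\<close>)
  have orth: "ip (x - ?p) m = 0" if m: "m \<in> M" for m
  proof (rule ip_swap_0)
    have "ip m (x - ?p) = ip (\<Sum>f\<in>F. ip m f *s f) (x - ?p)"
    by (simp only: orthonormal_basis_expansion[OF F m, symmetric])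
    also have "\<dots> = (\<Sum>f\<in>F. ip m f * ip f (x - ?p))"
      using F' x p subspace_H by (intro ip_sum_left) (auto intro!: subspace_diff)
    finally show "ip m (x - ?p) = 0" using pf by simp
  qed (use x p F' m subspace_H in \<open>auto intro!: subspace_diff\<close>)
  show "?p \<in> M \<and> (\<forall>m\<in>M. ip (x - ?p) m = 0)" using p orth by blast
  \<comment> \<open>The difference of two candidates lies in \<open>M\<close> and is orthogonal to \<open>M\<close>, hence to itself.\<close>
  fix q assume q: "q \<in> M \<and> (\<forall>m\<in>M. ip (x - q) m = 0)"
  define d where "d = q - ?p"
  have d: "d \<in> M" unfolding d_def using q p F' by (auto intro: subspace_diff)
  have "ip d d = ip ((x - ?p) - (x - q)) d" by (simp add: d_def)
  also have "\<dots> = 0"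
    using d q orth x p F' subspace_H by (subst ip_diff_left) (auto intro!: subspace_diff)
  finally have "d = 0" using ip_eq_0_iff d F' by auto
  then show "q = ?p" by (simp add: d_def)
qed

lemma ip_orth_proj_self:
  assumes F: "orthonormal_basis F M" and x: "x \<in> H"
  shows "ip (orth_proj ip M x) x = of_real (\<Sum>f\<in>F. (cmod (ip x f))\<^sup>2)"
  unfolding orth_proj_orthonormal_basis[OF F x]
  using ip_orthonormal_sum_self[OF orthonormal_basisD(1)[OF F] x] .

section \<open>Orthogonal complements and splitting\<close>

definition perp_in :: "'v set \<Rightarrow> 'v set \<Rightarrow> 'v set" where
  "perp_in W K = {x \<in> W. \<forall>k\<in>K. ip x k = 0}"

lemma subspace_perp_in:
  assumes "subspace W" "W \<subseteq> H" "K \<subseteq> H" shows "subspace (perp_in W K)"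
proof (rule subspaceI)
  show "0 \<in> perp_in W K" using assms subspace_0[of W] by (auto simp: perp_in_def ip_zero_left)
  show "x + y \<in> perp_in W K" if "x \<in> perp_in W K" "y \<in> perp_in W K" for x y
    using that assms ip_add_left by (auto simp: perp_in_def subspace_add subset_iff)
  show "c *s x \<in> perp_in W K" if "x \<in> perp_in W K" for c x
    using that assms ip_scale_left by (auto simp: perp_in_def subspace_scale subset_iff)
qed

lemma perp_in_Int: "K \<subseteq> H \<Longrightarrow> K \<inter> perp_in W K \<subseteq> {0}"
  using ip_eq_0_iff by (auto simp: perp_in_def)

lemma ip_orthogonal_basis:
  assumes E: "orthonormal_basis E K" and x: "x \<in> H" and orth: "\<And>e. e \<in> E \<Longrightarrow> ip x e = 0"
    and k: "k \<in> K"
  shows "ip x k = 0"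
proof (rule ip_swap_0)
  note E' = orthonormal_basisD[OF E]
  have "ip k x = ip (\<Sum>e\<in>E. ip k e *s e) x"
    by (simp only: orthonormal_basis_expansion[OF E k, symmetric])
  also have "\<dots> = (\<Sum>e\<in>E. ip k e * ip e x)" using E' x by (intro ip_sum_left) auto
  also have "\<dots> = 0"
  proof (rule sum.neutral, rule ballI)
    fix e assume e: "e \<in> E"
    then have "ip e x = 0" using E'(4) x orth[OF e] ip_swap_0[of x e] by auto
    then show "ip k e * ip e x = 0" by simp
  qed
  finally show "ip k x = 0" .
qed (use x k orthonormal_basisD[OF E] in auto)

text \<open>
  A basis of \<open>M\<close> that is adapted to \<open>K\<close>, each vector lying in \<open>K\<close> or orthogonal to it, lets one
  split vectors of \<open>M\<close> by splitting their basis expansion.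
\<close>

lemma split_of_basis:
  assumes F: "orthonormal_basis F M" and G: "G \<subseteq> F" "G \<subseteq> K" and K: "subspace K"
    and orth: "\<And>f k. f \<in> F - G \<Longrightarrow> k \<in> K \<Longrightarrow> ip f k = 0"
    and MW: "M \<subseteq> W" "subspace W" "W \<subseteq> H" "K \<subseteq> H" and x: "x \<in> M"
  shows "\<exists>a\<in>M \<inter> K. \<exists>b\<in>M \<inter> perp_in W K. x = a + b"
proof -
  note F' = orthonormal_basisD[OF F]
  let ?a = "\<Sum>f\<in>G. ip x f *s f" and ?b = "\<Sum>f\<in>F - G. ip x f *s f"
  have "x = ?b + ?a"
    by (rule trans[OF orthonormal_basis_expansion[OF F x] sum.subset_diff[OF G(1) F'(2)]])
  moreover have "?a \<in> M \<inter> K"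
    using G K F' by (intro subspace_sum subspace_scale subspace_inter) auto
  moreover have "?b \<in> M \<inter> perp_in W K"
    using orth F' MW subspace_perp_in[of W K]
    by (intro subspace_sum subspace_scale subspace_inter) (auto simp: perp_in_def)
  ultimately show ?thesis by (metis add.commute)
qed

lemma split_whole:
  assumes "subspace K" "K \<subseteq> W" "subspace W" "W \<subseteq> H" "x \<in> W"
  shows "\<exists>a\<in>K. \<exists>b\<in>perp_in W K. x = a + b"
proof -
  obtain E where E: "orthonormal_basis E K" using orthonormal_basis_exists assms by blast
  note E' = orthonormal_basisD[OF E]
  obtain F where F: "E \<subseteq> F" "orthonormal_basis F W"
    using orthonormal_basis_extend[of E W] E' assms by blast
  note F' = orthonormal_basisD[OF F(2)]
  have "ip f k = 0" if "f \<in> F - E" "k \<in> K" for f k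
  proof (rule ip_orthogonal_basis[OF E _ _ that(2)])
    show "f \<in> H" using that F'(4) by auto
    show "ip f e = 0" if "e \<in> E" for e
      using that \<open>f \<in> F - E\<close> F(1) F'(1) by (auto simp: orthonormal_def)
  qed
  then have "\<exists>a\<in>W \<inter> K. \<exists>b\<in>W \<inter> perp_in W K. x = a + b"
    using assms F E' by (intro split_of_basis[of F W E K W x]) auto
  then show ?thesis by blast
qed

section \<open>The weighted Parseval identity and the slope\<close>

text \<open>
  The quadratic form of \<open>\<Sum>s. \<chi> s P\<^sub>s = c I\<close> on \<open>W\<close>, where \<open>P\<^sub>s\<close> projects \<open>W\<close> onto \<open>U s \<inter> W\<close>. By
  Parseval, \<open>ip (P\<^sub>s x) x\<close> is the inner sum for any choice of the orthonormal basis \<open>F s\<close>; quantifying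
  over all choices lets each argument pick bases that suit it. The scalar \<open>c\<close> can be real because the
  form takes only real values.
\<close>

definition weighted_parseval ::
  "'s set \<Rightarrow> ('s \<Rightarrow> nat) \<Rightarrow> ('s \<Rightarrow> 'v set) \<Rightarrow> real \<Rightarrow> 'v set \<Rightarrow> bool" where
  "weighted_parseval S \<chi> U c W \<longleftrightarrow>
     (\<forall>F. (\<forall>s\<in>S. orthonormal_basis (F s) (U s \<inter> W)) \<longrightarrow>
        (\<forall>x\<in>W. (\<Sum>s\<in>S. real (\<chi> s) * (\<Sum>f\<in>F s. (cmod (ip x f))\<^sup>2)) = c * Re (ip x x)))"

lemma weighted_parseval_of_projections:
  assumes S: "finite S" and U: "\<And>s. s \<in> S \<Longrightarrow> U s \<subseteq> H"
    and proj: "\<And>x. x \<in> H \<Longrightarrow> (\<Sum>s\<in>S. of_nat (\<chi> s) *s orth_proj ip (U s) x) = \<chi>0 *s x"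
  shows "weighted_parseval S \<chi> U (Re \<chi>0) H"
  unfolding weighted_parseval_def
proof (intro allI impI ballI)
  fix F x assume F0: "\<forall>s\<in>S. orthonormal_basis (F s) (U s \<inter> H)" and x: "x \<in> H"
  have F: "orthonormal_basis (F s) (U s)" if "s \<in> S" for s
    using bspec[OF F0 that] Int_absorb2[OF U[OF that]] by simp
  have pH: "orth_proj ip (U s) x \<in> H" if "s \<in> S" for s
    unfolding orth_proj_orthonormal_basis[OF F[OF that] x]
    using orthonormal_basisD(4)[OF F[OF that]] subspace_H
    by (intro subspace_sum subspace_scale) auto
  have "\<chi>0 * ip x x = ip (\<Sum>s\<in>S. of_nat (\<chi> s) *s orth_proj ip (U s) x) x"
    using proj x by (simp add: ip_scale_left)
  also have "\<dots> = (\<Sum>s\<in>S. of_nat (\<chi> s) * ip (orth_proj ip (U s) x) x)"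
    using S pH x by (intro ip_sum_left)
  also have "\<dots> = of_real (\<Sum>s\<in>S. real (\<chi> s) * (\<Sum>f\<in>F s. (cmod (ip x f))\<^sup>2))"
    unfolding of_real_sum of_real_mult by (intro sum.cong refl) (simp add: ip_orth_proj_self[OF F x])
  finally have "Re (\<chi>0 * of_real (Re (ip x x))) =
      (\<Sum>s\<in>S. real (\<chi> s) * (\<Sum>f\<in>F s. (cmod (ip x f))\<^sup>2))"
    using ip_self_real[OF x] by simp
  then show "(\<Sum>s\<in>S. real (\<chi> s) * (\<Sum>f\<in>F s. (cmod (ip x f))\<^sup>2)) = Re \<chi>0 * Re (ip x x)"
    by simp
qed

text \<open>
  Both sides compute the trace of \<open>\<Sum>s. \<chi> s P\<^sub>s\<close> compressed to \<open>K\<close>: on the left the operator is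
  \<open>c I\<close>, on the right each trace is expanded in the basis \<open>E\<close>.
\<close>

lemma weighted_parseval_sum_basis:
  assumes wp: "weighted_parseval S \<chi> U c W"
    and F: "\<forall>s\<in>S. orthonormal_basis (F s) (U s \<inter> W)"
    and E: "orthonormal_basis E K" and KW: "K \<subseteq> W"
  shows "c * real (dim K) =
    (\<Sum>s\<in>S. real (\<chi> s) * (\<Sum>f\<in>F s. \<Sum>e\<in>E. (cmod (ip f e))\<^sup>2))"
proof -
  note E' = orthonormal_basisD[OF E]
  have "c * real (dim K) = (\<Sum>e\<in>E. c * Re (ip e e))"
    using E' by (simp add: orthonormal_def)
  also have "\<dots> = (\<Sum>e\<in>E. \<Sum>s\<in>S. real (\<chi> s) * (\<Sum>f\<in>F s. (cmod (ip e f))\<^sup>2))"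
  proof (rule sum.cong[OF refl])
    fix e assume "e \<in> E"
    then have "e \<in> W" using E'(3) KW by blast
    with wp F show "c * Re (ip e e) = (\<Sum>s\<in>S. real (\<chi> s) * (\<Sum>f\<in>F s. (cmod (ip e f))\<^sup>2))"
      unfolding weighted_parseval_def by simp
  qed
  also have "\<dots> = (\<Sum>s\<in>S. real (\<chi> s) * (\<Sum>e\<in>E. \<Sum>f\<in>F s. (cmod (ip e f))\<^sup>2))"
    by (subst sum.swap) (simp add: sum_distrib_left)
  also have "\<dots> = (\<Sum>s\<in>S. real (\<chi> s) * (\<Sum>f\<in>F s. \<Sum>e\<in>E. (cmod (ip f e))\<^sup>2))"
  proof (rule sum.cong[OF refl])
    fix s assume s: "s \<in> S"
    have "(\<Sum>e\<in>E. \<Sum>f\<in>F s. (cmod (ip e f))\<^sup>2) = (\<Sum>f\<in>F s. \<Sum>e\<in>E. (cmod (ip f e))\<^sup>2)"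
      using orthonormal_basisD(4)[OF bspec[OF F s]] E'(4)
      by (subst sum.swap) (intro sum.cong refl, metis norm_ip_swap subsetD)
    then show "real (\<chi> s) * (\<Sum>e\<in>E. \<Sum>f\<in>F s. (cmod (ip e f))\<^sup>2) =
        real (\<chi> s) * (\<Sum>f\<in>F s. \<Sum>e\<in>E. (cmod (ip f e))\<^sup>2)" by simp
  qed
  finally show ?thesis .
qed

lemma overlap_inside:
  assumes E: "orthonormal_basis E K" and G: "orthonormal G" "G \<subseteq> K"
  shows "(\<Sum>f\<in>G. \<Sum>e\<in>E. (cmod (ip f e))\<^sup>2) = real (card G)"
proof -
  have "(\<Sum>f\<in>G. \<Sum>e\<in>E. (cmod (ip f e))\<^sup>2) = (\<Sum>f\<in>G. 1)"
  proof (rule sum.cong[OF refl])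
    fix f assume f: "f \<in> G"
    have "(\<Sum>e\<in>E. (cmod (ip f e))\<^sup>2) = Re (ip f f)"
      using parseval[OF E, of f] f G(2) by auto
    then show "(\<Sum>e\<in>E. (cmod (ip f e))\<^sup>2) = 1" using f G(1) by (simp add: orthonormal_def)
  qed
  then show ?thesis by simp
qed

lemma overlap_split:
  assumes E: "orthonormal_basis E K" and F: "orthonormal F"
    and G: "orthonormal_basis G (M \<inter> K)" "G \<subseteq> F"
  shows "(\<Sum>f\<in>F. \<Sum>e\<in>E. (cmod (ip f e))\<^sup>2) =
    (\<Sum>f\<in>F - G. \<Sum>e\<in>E. (cmod (ip f e))\<^sup>2) + real (dim (M \<inter> K))"
proof -
  note G' = orthonormal_basisD[OF G(1)]
  have "finite F" using F by (simp add: orthonormal_def)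
  from sum.subset_diff[OF G(2) this, of "\<lambda>f. \<Sum>e\<in>E. (cmod (ip f e))\<^sup>2"]
  show ?thesis using overlap_inside[OF E G'(1)] G'(3,8) by auto
qed

lemma adapted_basis:
  assumes W: "subspace W" "W \<subseteq> H" and K: "subspace K" "K \<subseteq> W" and M: "subspace M"
  shows "\<exists>G F. orthonormal_basis G (M \<inter> K) \<and> G \<subseteq> F \<and> orthonormal_basis F (M \<inter> W)"
proof -
  obtain G where G: "orthonormal_basis G (M \<inter> K)"
    using orthonormal_basis_exists[of "M \<inter> K"] subspace_inter[OF M K(1)] W K by blast
  note G' = orthonormal_basisD[OF G]
  have "\<exists>F. G \<subseteq> F \<and> orthonormal_basis F (M \<inter> W)"
    using G' W K subspace_inter[OF M W(1)] by (intro orthonormal_basis_extend) auto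
  with G show ?thesis by blast
qed

lemma weighted_dim_whole:
  assumes wp: "weighted_parseval S \<chi> U c W" and W: "subspace W" "W \<subseteq> H"
    and U: "\<forall>s\<in>S. subspace (U s)"
  shows "(\<Sum>s\<in>S. real (\<chi> s) * real (dim (U s \<inter> W))) = c * real (dim W)"
proof -
  have "\<forall>s\<in>S. \<exists>F. orthonormal_basis F (U s \<inter> W)"
    using orthonormal_basis_exists subspace_inter[OF _ W(1)] U W(2) by blast
  then obtain F where F: "\<forall>s\<in>S. orthonormal_basis (F s) (U s \<inter> W)" by metis
  obtain B where B: "orthonormal_basis B W" using orthonormal_basis_exists W by blast
  show ?thesis
    unfolding weighted_parseval_sum_basis[OF wp F B subset_refl]
  proof (rule sum.cong[OF refl])
    fix s assume s: "s \<in> S"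
    note F' = orthonormal_basisD[OF bspec[OF F s]]
    have "F s \<subseteq> W" using F'(3) by blast
    then show "real (\<chi> s) * real (dim (U s \<inter> W)) =
        real (\<chi> s) * (\<Sum>f\<in>F s. \<Sum>e\<in>B. (cmod (ip f e))\<^sup>2)"
      by (simp only: overlap_inside[OF B F'(1)] F'(8))
  qed
qed

text \<open>
  The heart of the argument. Choose orthonormal bases \<open>E\<close> of \<open>K\<close> and \<open>F s\<close> of \<open>U s \<inter> W\<close>, the
  latter extending a basis \<open>G s\<close> of \<open>U s \<inter> K\<close>. Summing the weighted Parseval identity over \<open>E\<close>
  makes \<open>c * dim K\<close> the weighted sum of the overlaps of \<open>F s\<close> with \<open>E\<close>. The part \<open>G s\<close> accounts
  for \<open>dim (U s \<inter> K)\<close>, and the rest is a sum of squares \<open>d s\<close>: hence the inequality. Equality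
  together with positive weights forces every \<open>d s\<close> to vanish, so the vectors of \<open>F s\<close> outside
  \<open>G s\<close> are orthogonal to \<open>K\<close>, and \<open>U s \<inter> W\<close> splits along \<open>K\<close> and its complement.
\<close>

lemma
  assumes S: "finite S" and wp: "weighted_parseval S \<chi> U c W" and W: "subspace W" "W \<subseteq> H"
    and K: "subspace K" "K \<subseteq> W" and U: "\<forall>s\<in>S. subspace (U s)"
  shows weighted_dim_le: "(\<Sum>s\<in>S. real (\<chi> s) * real (dim (U s \<inter> K))) \<le> c * real (dim K)"
    and weighted_dim_eq_split: "\<lbrakk>(\<Sum>s\<in>S. real (\<chi> s) * real (dim (U s \<inter> K))) = c * real (dim K);
          \<forall>s\<in>S. 0 < \<chi> s; s \<in> S; x \<in> U s \<inter> W\<rbrakk>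
         \<Longrightarrow> \<exists>a\<in>U s \<inter> K. \<exists>b\<in>U s \<inter> perp_in W K. x = a + b"
proof -
  obtain E where E: "orthonormal_basis E K" using orthonormal_basis_exists K W by blast
  note E' = orthonormal_basisD[OF E]
  have "\<forall>s\<in>S. \<exists>G F. orthonormal_basis G (U s \<inter> K) \<and> G \<subseteq> F \<and> orthonormal_basis F (U s \<inter> W)"
    using adapted_basis[OF W K] U by blast
  then obtain G F where G: "\<And>s. s \<in> S \<Longrightarrow> orthonormal_basis (G s) (U s \<inter> K)"
    and GF: "\<And>s. s \<in> S \<Longrightarrow> G s \<subseteq> F s" and F0: "\<forall>s\<in>S. orthonormal_basis (F s) (U s \<inter> W)"
    by metis
  note F = bspec[OF F0]
  define d where "d s = (\<Sum>f\<in>F s - G s. \<Sum>e\<in>E. (cmod (ip f e))\<^sup>2)" for s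
  have d0: "0 \<le> d s" for s by (auto simp: d_def intro!: sum_nonneg)
  have "c * real (dim K) = (\<Sum>s\<in>S. real (\<chi> s) * (d s + real (dim (U s \<inter> K))))"
    unfolding weighted_parseval_sum_basis[OF wp F0 E K(2)] d_def
    by (rule sum.cong[OF refl])
      (simp only: overlap_split[OF E orthonormal_basisD(1)[OF F] G GF])
  then have eq: "c * real (dim K) =
      (\<Sum>s\<in>S. real (\<chi> s) * d s) + (\<Sum>s\<in>S. real (\<chi> s) * real (dim (U s \<inter> K)))"
    by (simp add: algebra_simps sum.distrib)
  show "(\<Sum>s\<in>S. real (\<chi> s) * real (dim (U s \<inter> K))) \<le> c * real (dim K)"
    unfolding eq using d0 by (simp add: sum_nonneg)
  show "\<exists>a\<in>U s \<inter> K. \<exists>b\<in>U s \<inter> perp_in W K. x = a + b"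
    if e: "(\<Sum>s\<in>S. real (\<chi> s) * real (dim (U s \<inter> K))) = c * real (dim K)"
      and \<chi>: "\<forall>s\<in>S. 0 < \<chi> s" and s: "s \<in> S" and x: "x \<in> U s \<inter> W"
  proof -
    have "(\<Sum>s\<in>S. real (\<chi> s) * d s) = 0" using eq e by simp
    then have "real (\<chi> s) * d s = 0"
      using sum_nonneg_eq_0_iff[OF S, of "\<lambda>s. real (\<chi> s) * d s"] d0 s by auto
    then have "d s = 0" using \<chi> s by auto
    moreover have fin: "finite (F s - G s)" using orthonormal_basisD(2)[OF F[OF s]] by simp
    ultimately have "\<forall>f\<in>F s - G s. (\<Sum>e\<in>E. (cmod (ip f e))\<^sup>2) = 0"
      unfolding d_def by (subst (asm) sum_nonneg_eq_0_iff) (auto intro!: sum_nonneg)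
    then have fe: "ip f e = 0" if "f \<in> F s - G s" "e \<in> E" for f e
      using that sum_nonneg_eq_0_iff[OF E'(2), of "\<lambda>e. (cmod (ip f e))\<^sup>2"] by auto
    have "ip f k = 0" if "f \<in> F s - G s" "k \<in> K" for f k
      by (rule ip_orthogonal_basis[OF E _ _ that(2)])
        (use that fe orthonormal_basisD(4)[OF F[OF s]] in auto)
    moreover have "G s \<subseteq> K" using orthonormal_basisD(3)[OF G[OF s]] by auto
    ultimately have "\<exists>a\<in>(U s \<inter> W) \<inter> K. \<exists>b\<in>(U s \<inter> W) \<inter> perp_in W K. x = a + b"
      using W K x GF[OF s] by (intro split_of_basis[OF F[OF s], of "G s" K W x]) auto
    then show ?thesis by blast
  qed
qed

text \<open>
  If \<open>A\<close> and \<open>B\<close> are orthogonal and every \<open>U s \<inter> W\<close> splits along them, an orthonormal basis of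
  \<open>U s \<inter> A\<close> joined with one of \<open>U s \<inter> B\<close> is one of \<open>U s \<inter> W\<close>. For \<open>x \<in> A\<close> the vectors from \<open>B\<close>
  contribute nothing, so the identity on \<open>W\<close> restricts to \<open>A\<close> with the same scalar.
\<close>

lemma weighted_parseval_summand:
  assumes wp: "weighted_parseval S \<chi> U c W" and W: "W \<subseteq> H" "subspace W"
    and AB: "subspace A" "subspace B" "A \<subseteq> W" "B \<subseteq> W"
    and orth: "\<And>a b. a \<in> A \<Longrightarrow> b \<in> B \<Longrightarrow> ip a b = 0"
    and U: "\<forall>s\<in>S. subspace (U s)"
    and split: "\<And>s x. s \<in> S \<Longrightarrow> x \<in> U s \<inter> W \<Longrightarrow> \<exists>a\<in>U s \<inter> A. \<exists>b\<in>U s \<inter> B. x = a + b"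
  shows "weighted_parseval S \<chi> U c A"
  unfolding weighted_parseval_def
proof (intro allI impI ballI)
  fix F x assume F: "\<forall>s\<in>S. orthonormal_basis (F s) (U s \<inter> A)" and x: "x \<in> A"
  have "\<forall>s\<in>S. \<exists>G. orthonormal_basis G (U s \<inter> B)"
    using orthonormal_basis_exists subspace_inter[OF _ AB(2)] U W AB by blast
  then obtain G where G: "\<forall>s\<in>S. orthonormal_basis (G s) (U s \<inter> B)" by metis
  \<comment> \<open>Disjointness matters: a vector in both bases would be counted once in the sum over the union.\<close>
  have un: "orthonormal_basis (F s \<union> G s) (U s \<inter> W) \<and> F s \<inter> G s = {} \<and>
      finite (F s) \<and> finite (G s) \<and> G s \<subseteq> B" if s: "s \<in> S" for s
  proof -
    note F' = orthonormal_basisD[OF bspec[OF F s]] and G' = orthonormal_basisD[OF bspec[OF G s]]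
    have o: "ip f g = 0" "ip g f = 0" if "f \<in> F s" "g \<in> G s" for f g
      using that F' G' orth ip_swap_0[of f g] by (auto simp: subset_iff)
    have disj: "F s \<inter> G s = {}" using o F'(1) by (force simp: orthonormal_def)
    have on: "orthonormal (F s \<union> G s)"
      using F'(1) G'(1) o disj unfolding orthonormal_def by auto
    have "span (F s \<union> G s) \<subseteq> U s \<inter> W"
      using F'(3) G'(3) AB subspace_inter[OF bspec[OF U s] W(2)] by (intro span_minimal) auto
    moreover have "U s \<inter> W \<subseteq> span (F s \<union> G s)"
    proof
      fix y assume "y \<in> U s \<inter> W"
      then obtain a b where ab: "a \<in> U s \<inter> A" "b \<in> U s \<inter> B" "y = a + b" using split s by blast
      have "a \<in> span (F s \<union> G s)" "b \<in> span (F s \<union> G s)"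
        using ab F'(7) G'(7) span_mono[of "F s" "F s \<union> G s"] span_mono[of "G s" "F s \<union> G s"] by auto
      then show "y \<in> span (F s \<union> G s)" using ab(3) span_add by auto
    qed
    ultimately show ?thesis using on disj F' G' by (auto simp: orthonormal_basis_def)
  qed
  have "(\<Sum>s\<in>S. real (\<chi> s) * (\<Sum>f\<in>F s \<union> G s. (cmod (ip x f))\<^sup>2)) = c * Re (ip x x)"
    using spec[OF wp[unfolded weighted_parseval_def], of "\<lambda>s. F s \<union> G s"] un x AB(3) by auto
  moreover have "(\<Sum>f\<in>F s \<union> G s. (cmod (ip x f))\<^sup>2) = (\<Sum>f\<in>F s. (cmod (ip x f))\<^sup>2)"
    if s: "s \<in> S" for s
    using un[OF s] orth[OF x] by (subst sum.union_disjoint) (auto intro!: sum.neutral)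
  ultimately show "(\<Sum>s\<in>S. real (\<chi> s) * (\<Sum>f\<in>F s. (cmod (ip x f))\<^sup>2)) = c * Re (ip x x)"
    by simp
qed

end

section \<open>Concatenating direct sums\<close>

context complex_vspace
begin

lemma sum_lessThan_concat:
  fixes f :: "nat \<Rightarrow> 'v"
  shows "(\<Sum>i<n + m. f i) = (\<Sum>i<n. f i) + (\<Sum>i<m. f (n + i))"
  by (induction m) (auto simp: algebra_simps)

lemma direct_sum_of_append:
  assumes A: "direct_sum_of n K A" "subspace A" and B: "direct_sum_of m L B" "subspace B"
    and AB: "A \<inter> B \<subseteq> {0}" and W: "\<And>x. x \<in> W \<longleftrightarrow> (\<exists>a\<in>A. \<exists>b\<in>B. x = a + b)"
  shows "direct_sum_of (n + m) (\<lambda>i. if i < n then K i else L (i - n)) W"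
proof -
  let ?M = "\<lambda>i. if i < n then K i else L (i - n)"
  have mem: "(\<forall>i<n + m. f i \<in> ?M i) \<longleftrightarrow> (\<forall>i<n. f i \<in> K i) \<and> (\<forall>i<m. f (n + i) \<in> L i)"
    for f :: "nat \<Rightarrow> 'v"
  proof safe
    fix i assume *: "\<forall>i<n + m. f i \<in> ?M i"
    show "i < n \<Longrightarrow> f i \<in> K i" using *[rule_format, of i] by simp
    show "i < m \<Longrightarrow> f (n + i) \<in> L i" using *[rule_format, of "n + i"] by simp
  next
    fix i assume fK: "\<forall>i<n. f i \<in> K i" and fL: "\<forall>i<m. f (n + i) \<in> L i" and i: "i < n + m"
    show "f i \<in> ?M i"
    proof (cases "i < n")
      case False
      then have "i - n < m" "n + (i - n) = i" using i by auto
      then show ?thesis using fL False by metis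
    qed (use fK in simp)
  qed
  have Aeq: "A = {\<Sum>i<n. f i |f. \<forall>i<n. f i \<in> K i}" and Beq: "B = {\<Sum>i<m. f i |f. \<forall>i<m. f i \<in> L i}"
    using A(1) B(1) by (simp_all add: direct_sum_of_def)
  have inA: "(\<Sum>i<n. f i) \<in> A" if "\<forall>i<n. f i \<in> K i" for f unfolding Aeq using that by blast
  have inB: "(\<Sum>i<m. f i) \<in> B" if "\<forall>i<m. f i \<in> L i" for f unfolding Beq using that by blast
  show ?thesis unfolding direct_sum_of_def
  proof (intro conjI)
    show "\<forall>i<n + m. subspace (?M i)" using A(1) B(1) by (auto simp: direct_sum_of_def)
    show "W = {\<Sum>i<n + m. f i |f. \<forall>i<n + m. f i \<in> ?M i}"
    proof (intro set_eqI iffI)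
      fix x assume "x \<in> W"
      then obtain a b where ab: "a \<in> A" "b \<in> B" "x = a + b" using W by blast
      obtain f where f: "a = (\<Sum>i<n. f i)" "\<forall>i<n. f i \<in> K i" using ab(1) unfolding Aeq by blast
      obtain g where g: "b = (\<Sum>i<m. g i)" "\<forall>i<m. g i \<in> L i" using ab(2) unfolding Beq by blast
      define h where "h i = (if i < n then f i else g (i - n))" for i
      have "x = (\<Sum>i<n + m. h i)" unfolding sum_lessThan_concat ab(3) f(1) g(1) by (simp add: h_def)
      moreover have "\<forall>i<n + m. h i \<in> ?M i" unfolding mem using f g by (simp add: h_def)
      ultimately show "x \<in> {\<Sum>i<n + m. f i |f. \<forall>i<n + m. f i \<in> ?M i}" by blast
    next
      fix x assume "x \<in> {\<Sum>i<n + m. f i |f. \<forall>i<n + m. f i \<in> ?M i}"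
      then obtain f where f: "x = (\<Sum>i<n + m. f i)" "\<forall>i<n + m. f i \<in> ?M i" by blast
      then show "x \<in> W" unfolding W sum_lessThan_concat mem
        using inA[of f] inB[of "\<lambda>i. f (n + i)"] by blast
    qed
    show "\<forall>f. (\<forall>i<n + m. f i \<in> ?M i) \<and> (\<Sum>i<n + m. f i) = 0 \<longrightarrow> (\<forall>i<n + m. f i = 0)"
    proof (intro allI impI)
      fix f i assume f: "(\<forall>i<n + m. f i \<in> ?M i) \<and> (\<Sum>i<n + m. f i) = 0" and i: "i < n + m"
      let ?a = "\<Sum>i<n. f i" and ?b = "\<Sum>i<m. f (n + i)"
      have fK: "\<forall>i<n. f i \<in> K i" and fL: "\<forall>i<m. f (n + i) \<in> L i" using f mem by auto
      \<comment> \<open>\<open>?a = - ?b\<close> lies in both \<open>A\<close> and \<open>B\<close>, so each of the two partial sums vanishes.\<close>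
      have sum: "?a + ?b = 0" using f sum_lessThan_concat[of f n m] by simp
      then have ab: "?a = - ?b" by (simp add: eq_neg_iff_add_eq_0)
      then have "?a \<in> A \<inter> B"
        using inA[OF fK] inB[OF fL] subspace_neg[OF B(2)] by auto
      then have a0: "?a = 0" using AB by auto
      with sum have b0: "?b = 0" by simp
      have Z: "\<forall>i<n. f i = 0" using a0 fK A(1) unfolding direct_sum_of_def by blast
      have "\<forall>g. (\<forall>i<m. g i \<in> L i) \<and> (\<Sum>i<m. g i) = 0 \<longrightarrow> (\<forall>i<m. g i = 0)"
        using B(1) unfolding direct_sum_of_def by blast
      from spec[OF this, of "\<lambda>i. f (n + i)"] have Z': "\<forall>i<m. f (n + i) = 0" using b0 fL by blast
      show "f i = 0"
      proof (cases "i < n")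
        case False
        then have "i - n < m" "n + (i - n) = i" using i by auto
        then show ?thesis using Z' by metis
      qed (use Z in simp)
    qed
  qed
qed

lemma direct_sum_of_single:
  assumes "subspace W" shows "direct_sum_of 1 (\<lambda>_. W) W"
  unfolding direct_sum_of_def using assms by (auto intro: exI[of _ "\<lambda>_. _"])

lemma restrict_restrict: "K \<subseteq> W \<Longrightarrow> restrict_rep (restrict_rep V W) K = restrict_rep V K"
  by (auto simp: restrict_rep_def)

end

section \<open>Polystability\<close>

context finite_dim_inner_product_space
begin

lemma subspace_rep_restrict:
  assumes "subspace_rep S r V0 V" "V0 \<subseteq> H" "subspace W" "W \<noteq> {0}" "W \<subseteq> V0"
  shows "subspace_rep S r W (restrict_rep V W)"
proof -
  obtain F where F: "orthonormal_basis F W" using orthonormal_basis_exists[of W] assms by auto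
  then have "\<exists>B. finite B \<and> span B = W" using orthonormal_basisD(2,7)[OF F] by blast
  moreover have "\<forall>s\<in>S. subspace (V s \<inter> W)" "\<forall>s\<in>S. \<forall>t\<in>S. (s, t) \<in> r \<longrightarrow> V s \<inter> W \<subseteq> V t \<inter> W"
    using assms(1,3) subspace_inter unfolding subspace_rep_def by blast+
  ultimately show ?thesis using assms(3,4) unfolding subspace_rep_def restrict_rep_def by simp
qed

lemma slope_le_iff:
  assumes "subspace K" "K \<noteq> {0}" "K \<subseteq> H"
  shows "slope S \<theta> K (restrict_rep U K) \<le> c \<longleftrightarrow>
      (\<Sum>s\<in>S. \<theta> s * real (dim (U s \<inter> K))) \<le> c * real (dim K)"
    and "slope S \<theta> K (restrict_rep U K) = c \<longleftrightarrow>
      (\<Sum>s\<in>S. \<theta> s * real (dim (U s \<inter> K))) = c * real (dim K)"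
  using dim_pos[OF assms] by (simp_all add: slope_def restrict_rep_def field_simps)

lemma weighted_parseval_slope:
  assumes S: "finite S" and wp: "weighted_parseval S \<chi> U c W" and W: "subspace W" "W \<subseteq> H"
    and U: "\<forall>s\<in>S. subspace (U s)" and K: "subspace K" "K \<noteq> {0}" "K \<subseteq> W"
  shows "slope S (\<lambda>s. real (\<chi> s)) K (restrict_rep U K) \<le> c"
    and "slope S (\<lambda>s. real (\<chi> s)) W (restrict_rep U W) = c"
proof -
  show "slope S (\<lambda>s. real (\<chi> s)) K (restrict_rep U K) \<le> c"
    using slope_le_iff(1)[OF K(1,2) subset_trans[OF K(3) W(2)], of S "\<lambda>s. real (\<chi> s)" U c]
      weighted_dim_le[OF S wp W K(1,3) U]
    by simp
  have "W \<noteq> {0}" using K subspace_0[OF K(1)] by auto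
  then show "slope S (\<lambda>s. real (\<chi> s)) W (restrict_rep U W) = c"
    using slope_le_iff(2)[OF W(1) _ W(2), of S "\<lambda>s. real (\<chi> s)" U c]
      weighted_dim_whole[OF wp W U]
    by simp
qed

text \<open>
  Induction on \<open>dim W\<close>. If \<open>W\<close> is not stable, some proper \<open>K\<close> has slope at least that of \<open>W\<close>, hence
  exactly \<open>c\<close>, and the equality case splits \<open>W\<close> into \<open>K\<close> and its orthogonal complement. The
  representation \<open>U\<close> stays fixed and only \<open>W\<close> varies, so that a summand of a summand is again \<open>U\<close>
  restricted to a subspace.
\<close>

lemma weighted_parseval_decomposition:
  assumes S: "finite S" and pos: "\<forall>s\<in>S. 0 < \<chi> s" and U: "subspace_rep S r H U"
    and W: "subspace W" "W \<noteq> {0}" "W \<subseteq> H" "weighted_parseval S \<chi> U c W"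
  shows "\<exists>n K. direct_sum_of n K W \<and>
    (\<forall>s\<in>S. direct_sum_of n (\<lambda>i. U s \<inter> K i) (U s \<inter> W)) \<and>
    (\<forall>i<n. mu_stable S r (\<lambda>s. real (\<chi> s)) (K i) (restrict_rep U (K i)))"
  using W
proof (induction "dim W" arbitrary: W rule: less_induct)
  case less
  let ?\<theta> = "\<lambda>s. real (\<chi> s)"
  have Us: "\<forall>s\<in>S. subspace (U s)" using U by (auto simp: subspace_rep_def)
  note W = less.prems
  show ?case
  proof (cases "mu_stable S r ?\<theta> W (restrict_rep U W)")
    case True
    then show ?thesis
      using direct_sum_of_single[OF W(1)] direct_sum_of_single[OF subspace_inter[OF bspec[OF Us] W(1)]]
      by (intro exI[of _ 1] exI[of _ "\<lambda>_. W"]) auto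
  next
    case False
    then obtain K where K: "subspace K" "K \<noteq> {0}" "K \<subset> W"
      and ge': "slope S ?\<theta> W (restrict_rep U W) \<le>
        slope S ?\<theta> K (restrict_rep (restrict_rep U W) K)"
      using subspace_rep_restrict[OF U subset_refl W(1-3)] not_less
      unfolding mu_stable_def by blast
    from ge' have ge: "slope S ?\<theta> W (restrict_rep U W) \<le> slope S ?\<theta> K (restrict_rep U K)"
      using K(3) by (simp add: restrict_restrict)
    have KW: "K \<subseteq> W" "K \<subseteq> H" using K W by auto
    note sl = weighted_parseval_slope[OF S W(4,1,3) Us K(1,2) KW(1)]
    have "slope S ?\<theta> K (restrict_rep U K) = c" using sl ge by simp
    then have eq: "(\<Sum>s\<in>S. ?\<theta> s * real (dim (U s \<inter> K))) = c * real (dim K)"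
      using slope_le_iff(2)[OF K(1,2) KW(2), of S ?\<theta> U c] by simp
    define L where "L = perp_in W K"
    have L: "subspace L" "L \<subseteq> W" using subspace_perp_in[OF W(1,3) KW(2)] by (auto simp: L_def perp_in_def)
    have KL: "K \<inter> L \<subseteq> {0}" using perp_in_Int[OF KW(2)] by (simp add: L_def)
    have LK: "ip b a = 0" if "a \<in> K" "b \<in> L" for a b using that by (simp add: L_def perp_in_def)
    have KLo: "ip a b = 0" if "a \<in> K" "b \<in> L" for a b
      using LK[OF that] ip_swap_0[of b a] that KW L W by blast
    have spl: "\<exists>a\<in>U s \<inter> K. \<exists>b\<in>U s \<inter> L. x = a + b" if "s \<in> S" "x \<in> U s \<inter> W" for s x
      unfolding L_def by (rule weighted_dim_eq_split[OF S W(4,1,3) K(1) KW(1) Us eq pos that])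
    have spl': "\<exists>a\<in>U s \<inter> L. \<exists>b\<in>U s \<inter> K. x = a + b" if "s \<in> S" "x \<in> U s \<inter> W" for s x
      using spl[OF that] by (metis add.commute)
    have wpK: "weighted_parseval S \<chi> U c K"
      by (rule weighted_parseval_summand[OF W(4,3,1) K(1) L(1) KW(1) L(2) KLo Us spl])
    have wpL: "weighted_parseval S \<chi> U c L"
      by (rule weighted_parseval_summand[OF W(4,3,1) L(1) K(1) L(2) KW(1) LK Us spl'])
    have split_W: "\<exists>a\<in>K. \<exists>b\<in>L. x = a + b" if "x \<in> W" for x
      unfolding L_def by (rule split_whole[OF K(1) KW(1) W(1,3) that])
    have L0: "L \<noteq> {0}" using split_W K(3) by auto
    have LW: "L \<subset> W" using KL K KW L subspace_0[OF K(1)] by auto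
    obtain n A where A: "direct_sum_of n A K"
      "\<forall>s\<in>S. direct_sum_of n (\<lambda>i. U s \<inter> A i) (U s \<inter> K)"
      "\<forall>i<n. mu_stable S r ?\<theta> (A i) (restrict_rep U (A i))"
      using less.hyps[OF dim_strict_mono[OF K(1) W(1) K(3) W(3)] K(1,2) KW(2) wpK] by blast
    have "L \<subseteq> H" using L W by auto
    then obtain m B where B: "direct_sum_of m B L"
      "\<forall>s\<in>S. direct_sum_of m (\<lambda>i. U s \<inter> B i) (U s \<inter> L)"
      "\<forall>i<m. mu_stable S r ?\<theta> (B i) (restrict_rep U (B i))"
      using less.hyps[OF dim_strict_mono[OF L(1) W(1) LW W(3)] L(1) L0 _ wpL] by blast
    define C where "C i = (if i < n then A i else B (i - n))" for i
    have "direct_sum_of (n + m) C W"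
      unfolding C_def
      by (rule direct_sum_of_append[OF A(1) K(1) B(1) L(1) KL])
        (use split_W subspace_add[OF W(1)] KW L in blast)
    moreover have "direct_sum_of (n + m) (\<lambda>i. U s \<inter> C i) (U s \<inter> W)" if s: "s \<in> S" for s
    proof -
      have mem: "x \<in> U s \<inter> W \<longleftrightarrow> (\<exists>a\<in>U s \<inter> K. \<exists>b\<in>U s \<inter> L. x = a + b)" for x
        using spl[OF s] subspace_add[OF subspace_inter[OF bspec[OF Us s] W(1)]] KW L by blast
      have eqC: "(\<lambda>i. U s \<inter> C i) = (\<lambda>i. if i < n then U s \<inter> A i else U s \<inter> B (i - n))"
        by (intro ext) (simp add: C_def)
      show ?thesis
        unfolding eqC
        by (rule direct_sum_of_append[OF bspec[OF A(2) s] subspace_inter[OF bspec[OF Us s] K(1)]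
              bspec[OF B(2) s] subspace_inter[OF bspec[OF Us s] L(1)] _ mem]) (use KL in blast)
    qed
    moreover have "mu_stable S r ?\<theta> (C i) (restrict_rep U (C i))" if "i < n + m" for i
      using A(3) B(3) that by (auto simp: C_def)
    ultimately show ?thesis by blast
  qed
qed

end

theorem proposition6p1:
  fixes scale :: "complex \<Rightarrow> 'v::ab_group_add \<Rightarrow> 'v"
    and ip :: "'v \<Rightarrow> 'v \<Rightarrow> complex"
    and S :: "'s set" and r :: "'s rel"
    and \<chi> :: "'s \<Rightarrow> nat"
    and U0 :: "'v set" and U :: "'s \<Rightarrow> 'v set"
  assumes "complex_vspace scale"
    and "finite S" and "partial_order_on S r"
    and "\<forall>s\<in>S. 0 < \<chi> s"
    and "complex_vspace.chi_rep scale ip S r \<chi> U0 U"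
  shows "complex_vspace.mu_polystable scale S r (\<lambda>s. real (\<chi> s)) U0 U"
proof -
  interpret complex_vspace scale by fact
  obtain \<chi>0 where rep: "subspace_rep S r U0 U" and ipU: "inner_product_on U0 ip"
    and proj: "\<And>x. x \<in> U0 \<Longrightarrow> (\<Sum>s\<in>S. scale (of_nat (\<chi> s)) (orth_proj ip (U s) x)) = scale \<chi>0 x"
    using assms(5) by (auto simp: chi_rep_def unitary_rep_def)
  have U0: "subspace U0" "U0 \<noteq> {0}" "\<exists>B. finite B \<and> span B = U0"
    and U: "\<forall>s\<in>S. subspace (U s)" "\<And>s. s \<in> S \<Longrightarrow> U s \<subseteq> U0"
    using rep by (auto simp: subspace_rep_def)
  interpret finite_dim_inner_product_space scale ip U0
    by unfold_locales (use U0 ipU in auto)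
  let ?\<theta> = "\<lambda>s. real (\<chi> s)"
  have wp: "weighted_parseval S \<chi> U (Re \<chi>0) U0"
    by (rule weighted_parseval_of_projections[OF assms(2) U(2) proj])
  have UU: "U s \<inter> U0 = U s" if "s \<in> S" for s using U(2)[OF that] by auto
  have slope_U: "slope S ?\<theta> U0 U = Re \<chi>0"
    using weighted_parseval_slope(2)[OF assms(2) wp U0(1) subset_refl U(1) U0(1,2) subset_refl]
    by (simp add: slope_def restrict_rep_def UU)
  have "mu_semistable S r ?\<theta> U0 U"
    unfolding mu_semistable_def slope_U
    using rep weighted_parseval_slope(1)[OF assms(2) wp U0(1) subset_refl U(1)] by auto
  moreover obtain n K where "direct_sum_of n K U0"
    "\<forall>s\<in>S. direct_sum_of n (\<lambda>i. U s \<inter> K i) (U s \<inter> U0)"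
    "\<forall>i<n. mu_stable S r ?\<theta> (K i) (restrict_rep U (K i))"
    using weighted_parseval_decomposition[OF assms(2,4) rep U0(1,2) subset_refl wp] by blast
  ultimately show ?thesis
    unfolding mu_polystable_def restrict_rep_def by (metis UU)
qed

end
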